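(* If $(\mathcal{C},\otimes,I,\alpha,\lambda,\rho)$ is a weakly normal skew monoidal category, then the monoid $\mathrm{End}(I)=\mathcal{C}(I,I)$ of endomorphisms of the unit object $I$ (under composition) is commutative.
   Context: A skew monoidal category $(\mathcal{C},\otimes,I,\alpha,\lambda,\rho)$ consists of a category $\mathcal{C}$, a functor $\otimes:\mathcal{C}\times\mathcal{C}\to\mathcal{C}$, an object $I$, and natural transformations (not assumed invertible) $\alpha_{X,Y,Z}:(X\otimes Y)\otimes Z\to X\otimes(Y\otimes Z)$, $\lambda_X:I\otimes X\to X$, $\rho_X:X\to X\otimes I$ such that for all $W,X,Y,Z$: - $\alpha_{W,X,Y\otimes Z}\circ\alpha_{W\otimes X,Y,Z}=(1_W\otimes\alpha_{X,Y,Z})\circ\alpha_{W,X\otimes Y,Z}\circ(\alpha_{W,X,Y}\otimes 1_Z)$; - $\lambda_{X\otimes Y}\circ\alpha_{I,X,Y}=\lambda_X\otimes 1_Y$; - $(1_X\otimes\lambda_Y)\circ\alpha_{X,I,Y}\circ(\rho_X\otimes 1_Y)=1_{X\otimes Y}$; - $\alpha_{X,Y,I}\circ\rho_{X\otimes Y}=1_X\otimes\rho_Y$; - $\lambda_I\circ\rho_I=1_I$. It is weakly normal if moreover $\rho_I\circ\lambda_I=1_{I\otimes I}$ (equivalently, $\lambda_I:I\otimes I\to I$ is invertible). *)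

theory Defs
  imports "HOL-Algebra.Group"
begin

section \<open>Categories, functors, natural transformations\<close>

text \<open>
  Objects and arrows are carved out of their types by carrier sets. Composition \<open>g \<cdot>\<^bsub>C\<^esub> f\<close> is
  written in the usual order (first \<open>f\<close>, then \<open>g\<close>); it is a total function whose value is
  unspecified unless \<open>f\<close> and \<open>g\<close> are arrows with \<open>Cod C f = Dom C g\<close>.
\<close>

record ('o, 'a) cat =
  Ob :: "'o set"
  Arr :: "'a set"
  Dom :: "'a \<Rightarrow> 'o"
  Cod :: "'a \<Rightarrow> 'o"
  Ident :: "'o \<Rightarrow> 'a"
  Comp :: "'a \<Rightarrow> 'a \<Rightarrow> 'a" (infixr \<open>\<cdot>\<index>\<close> 65)

definition homset :: "('o, 'a) cat \<Rightarrow> 'o \<Rightarrow> 'o \<Rightarrow> 'a set" where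
  "homset C X Y = {f \<in> Arr C. Dom C f = X \<and> Cod C f = Y}"

locale category =
  fixes C :: "('o, 'a) cat"
  assumes Dom_Ob: "f \<in> Arr C \<Longrightarrow> Dom C f \<in> Ob C"
    and Cod_Ob: "f \<in> Arr C \<Longrightarrow> Cod C f \<in> Ob C"
    and Ident_homset: "X \<in> Ob C \<Longrightarrow> Ident C X \<in> homset C X X"
    and Comp_homset:
      "\<lbrakk>f \<in> homset C X Y; g \<in> homset C Y Z\<rbrakk> \<Longrightarrow> g \<cdot>\<^bsub>C\<^esub> f \<in> homset C X Z"
    and Comp_Ident_right: "f \<in> homset C X Y \<Longrightarrow> f \<cdot>\<^bsub>C\<^esub> Ident C X = f"
    and Comp_Ident_left: "f \<in> homset C X Y \<Longrightarrow> Ident C Y \<cdot>\<^bsub>C\<^esub> f = f"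
    and Comp_assoc:
      "\<lbrakk>f \<in> homset C W X; g \<in> homset C X Y; h \<in> homset C Y Z\<rbrakk>
        \<Longrightarrow> (h \<cdot>\<^bsub>C\<^esub> g) \<cdot>\<^bsub>C\<^esub> f = h \<cdot>\<^bsub>C\<^esub> (g \<cdot>\<^bsub>C\<^esub> f)"

definition prod_cat ::
  "('o, 'a) cat \<Rightarrow> ('p, 'b) cat \<Rightarrow> ('o \<times> 'p, 'a \<times> 'b) cat" (infixl \<open>\<times>\<^sub>C\<close> 70) where
  "C \<times>\<^sub>C D =
    \<lparr>Ob = Ob C \<times> Ob D,
     Arr = Arr C \<times> Arr D,
     Dom = (\<lambda>(f, g). (Dom C f, Dom D g)),
     Cod = (\<lambda>(f, g). (Cod C f, Cod D g)),
     Ident = (\<lambda>(X, Y). (Ident C X, Ident D Y)),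
     Comp = (\<lambda>(f', g') (f, g). (f' \<cdot>\<^bsub>C\<^esub> f, g' \<cdot>\<^bsub>D\<^esub> g))\<rparr>"

locale cat_functor = source: category C + target: category D
  for C :: "('o, 'a) cat" and D :: "('p, 'b) cat" +
  fixes F_ob :: "'o \<Rightarrow> 'p" and F_arr :: "'a \<Rightarrow> 'b"
  assumes F_ob_Ob: "X \<in> Ob C \<Longrightarrow> F_ob X \<in> Ob D"
    and F_arr_homset: "f \<in> homset C X Y \<Longrightarrow> F_arr f \<in> homset D (F_ob X) (F_ob Y)"
    and F_arr_Ident: "X \<in> Ob C \<Longrightarrow> F_arr (Ident C X) = Ident D (F_ob X)"
    and F_arr_Comp:
      "\<lbrakk>f \<in> homset C X Y; g \<in> homset C Y Z\<rbrakk>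
        \<Longrightarrow> F_arr (g \<cdot>\<^bsub>C\<^esub> f) = F_arr g \<cdot>\<^bsub>D\<^esub> F_arr f"

locale nat_trans =
  F: cat_functor C D F_ob F_arr + G: cat_functor C D G_ob G_arr
  for C :: "('o, 'a) cat" and D :: "('p, 'b) cat"
    and F_ob F_arr and G_ob G_arr +
  fixes t :: "'o \<Rightarrow> 'b"
  assumes component_homset: "X \<in> Ob C \<Longrightarrow> t X \<in> homset D (F_ob X) (G_ob X)"
    and naturality:
      "f \<in> homset C X Y \<Longrightarrow> t Y \<cdot>\<^bsub>D\<^esub> F_arr f = G_arr f \<cdot>\<^bsub>D\<^esub> t X"

section \<open>Skew monoidal categories\<close>

text \<open>
  The tensor functor is given in curried form by its action \<open>\<otimes>\<^sub>o\<close> on objects and \<open>\<otimes>\<^sub>a\<close> on arrows.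
\<close>

locale skew_monoidal_category =
  category C +
  tensor: cat_functor "C \<times>\<^sub>C C" C "\<lambda>(X, Y). X \<otimes>\<^sub>o Y" "\<lambda>(f, g). f \<otimes>\<^sub>a g" +
  alpha: nat_trans "(C \<times>\<^sub>C C) \<times>\<^sub>C C" C
    "\<lambda>((X, Y), Z). (X \<otimes>\<^sub>o Y) \<otimes>\<^sub>o Z" "\<lambda>((f, g), h). (f \<otimes>\<^sub>a g) \<otimes>\<^sub>a h"
    "\<lambda>((X, Y), Z). X \<otimes>\<^sub>o (Y \<otimes>\<^sub>o Z)" "\<lambda>((f, g), h). f \<otimes>\<^sub>a (g \<otimes>\<^sub>a h)"
    "\<lambda>((X, Y), Z). \<alpha> X Y Z" +
  lambda: nat_trans C C
    "\<lambda>X. I \<otimes>\<^sub>o X" "\<lambda>f. Ident C I \<otimes>\<^sub>a f" "\<lambda>X. X" "\<lambda>f. f" \<l> +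
  rho: nat_trans C C
    "\<lambda>X. X" "\<lambda>f. f" "\<lambda>X. X \<otimes>\<^sub>o I" "\<lambda>f. f \<otimes>\<^sub>a Ident C I" \<rho>
  for C :: "('o, 'a) cat"
    and tensor_ob :: "'o \<Rightarrow> 'o \<Rightarrow> 'o" (infix \<open>\<otimes>\<^sub>o\<close> 70)
    and tensor_arr :: "'a \<Rightarrow> 'a \<Rightarrow> 'a" (infix \<open>\<otimes>\<^sub>a\<close> 70)
    and I :: 'o
    and \<alpha> :: "'o \<Rightarrow> 'o \<Rightarrow> 'o \<Rightarrow> 'a"
    and \<l> :: "'o \<Rightarrow> 'a"
    and \<rho> :: "'o \<Rightarrow> 'a" +
  assumes unit_Ob: "I \<in> Ob C"
    and pentagon:
      "\<lbrakk>W \<in> Ob C; X \<in> Ob C; Y \<in> Ob C; Z \<in> Ob C\<rbrakk> \<Longrightarrow>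
        \<alpha> W X (Y \<otimes>\<^sub>o Z) \<cdot>\<^bsub>C\<^esub> \<alpha> (W \<otimes>\<^sub>o X) Y Z =
        (Ident C W \<otimes>\<^sub>a \<alpha> X Y Z) \<cdot>\<^bsub>C\<^esub> \<alpha> W (X \<otimes>\<^sub>o Y) Z \<cdot>\<^bsub>C\<^esub> (\<alpha> W X Y \<otimes>\<^sub>a Ident C Z)"
    and left_unit:
      "\<lbrakk>X \<in> Ob C; Y \<in> Ob C\<rbrakk> \<Longrightarrow>
        \<l> (X \<otimes>\<^sub>o Y) \<cdot>\<^bsub>C\<^esub> \<alpha> I X Y = \<l> X \<otimes>\<^sub>a Ident C Y"
    and middle_unit:
      "\<lbrakk>X \<in> Ob C; Y \<in> Ob C\<rbrakk> \<Longrightarrow>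
        (Ident C X \<otimes>\<^sub>a \<l> Y) \<cdot>\<^bsub>C\<^esub> \<alpha> X I Y \<cdot>\<^bsub>C\<^esub> (\<rho> X \<otimes>\<^sub>a Ident C Y) = Ident C (X \<otimes>\<^sub>o Y)"
    and right_unit:
      "\<lbrakk>X \<in> Ob C; Y \<in> Ob C\<rbrakk> \<Longrightarrow>
        \<alpha> X Y I \<cdot>\<^bsub>C\<^esub> \<rho> (X \<otimes>\<^sub>o Y) = Ident C X \<otimes>\<^sub>a \<rho> Y"
    and unit_unit: "\<l> I \<cdot>\<^bsub>C\<^esub> \<rho> I = Ident C I"

locale weakly_normal_skew_monoidal_category = skew_monoidal_category +
  assumes weakly_normal: "\<rho> I \<cdot>\<^bsub>C\<^esub> \<l> I = Ident C (I \<otimes>\<^sub>o I)"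

definition End_monoid :: "('o, 'a) cat \<Rightarrow> 'o \<Rightarrow> 'a monoid" where
  "End_monoid C X = \<lparr>carrier = homset C X X, mult = Comp C, one = Ident C X\<rparr>"

end

theory Submission
  imports Defs
begin

text \<open>
  Write \<open>1\<close> for identities. Naturality of \<open>\<rho>\<close> and \<open>\<l>\<close> at an endomorphism \<open>f\<close> of \<open>I\<close> says that
  \<open>\<rho>\<^sub>I \<cdot> f = (f \<otimes> 1) \<cdot> \<rho>\<^sub>I\<close> and \<open>\<l>\<^sub>I \<cdot> (1 \<otimes> f) = f \<cdot> \<l>\<^sub>I\<close>. When \<open>\<rho>\<^sub>I\<close> and \<open>\<l>\<^sub>I\<close> are mutually inverse, both
  \<open>f \<otimes> 1\<close> and \<open>1 \<otimes> f\<close> are therefore the same conjugate \<open>\<rho>\<^sub>I \<cdot> f \<cdot> \<l>\<^sub>I\<close> of \<open>f\<close>. Since \<open>f \<otimes> 1\<close> commutes with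
  \<open>1 \<otimes> g\<close> by functoriality of the tensor product, the conjugates of \<open>f\<close> and \<open>g\<close> commute, and
  hence so do \<open>f\<close> and \<open>g\<close>, because conjugation is multiplicative and injective.
\<close>

lemma (in category) End_monoid_is_monoid:
  assumes "X \<in> Ob C"
  shows "Group.monoid (End_monoid C X)"
  by (rule monoidI)
    (use assms Ident_homset Comp_homset Comp_Ident_left Comp_Ident_right Comp_assoc in
      \<open>auto simp: End_monoid_def\<close>)

lemma homset_prod_cat:
  "(f, g) \<in> homset (C \<times>\<^sub>C D) (X, Y) (X', Y') \<longleftrightarrow> f \<in> homset C X X' \<and> g \<in> homset D Y Y'"
  by (auto simp: homset_def prod_cat_def)

context skew_monoidal_category
begin

lemma tensor_homset:
  assumes "f \<in> homset C X X'" and "g \<in> homset C Y Y'"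
  shows "f \<otimes>\<^sub>a g \<in> homset C (X \<otimes>\<^sub>o Y) (X' \<otimes>\<^sub>o Y')"
  using tensor.F_arr_homset[of "(f, g)" "(X, Y)" "(X', Y')"] assms
  by (simp add: homset_prod_cat)

lemma tensor_Comp:
  assumes "f \<in> homset C X X'" and "f' \<in> homset C X' X''"
    and "g \<in> homset C Y Y'" and "g' \<in> homset C Y' Y''"
  shows "(f' \<otimes>\<^sub>a g') \<cdot>\<^bsub>C\<^esub> (f \<otimes>\<^sub>a g) = (f' \<cdot>\<^bsub>C\<^esub> f) \<otimes>\<^sub>a (g' \<cdot>\<^bsub>C\<^esub> g)"
  using tensor.F_arr_Comp[of "(f, g)" "(X, Y)" "(X', Y')" "(f', g')" "(X'', Y'')"] assms
  by (simp add: homset_prod_cat) (simp add: prod_cat_def)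

lemma tensor_interchange:
  assumes f: "f \<in> homset C X X'" and g: "g \<in> homset C Y Y'"
  shows "(f \<otimes>\<^sub>a Ident C Y') \<cdot>\<^bsub>C\<^esub> (Ident C X \<otimes>\<^sub>a g) = (Ident C X' \<otimes>\<^sub>a g) \<cdot>\<^bsub>C\<^esub> (f \<otimes>\<^sub>a Ident C Y)"
proof -
  have ids: "Ident C X \<in> homset C X X" "Ident C X' \<in> homset C X' X'"
      "Ident C Y \<in> homset C Y Y" "Ident C Y' \<in> homset C Y' Y'"
    using f g Dom_Ob Cod_Ob by (auto simp: homset_def intro!: Ident_homset[unfolded homset_def, simplified])
  show ?thesis
    using f g ids by (simp add: tensor_Comp Comp_Ident_left Comp_Ident_right)
qed

lemma lambda_I_homset: "\<l> I \<in> homset C (I \<otimes>\<^sub>o I) I"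
  and rho_I_homset: "\<rho> I \<in> homset C I (I \<otimes>\<^sub>o I)"
  and Ident_I_homset: "Ident C I \<in> homset C I I"
  using lambda.component_homset rho.component_homset Ident_homset unit_Ob by auto

text \<open>
  This retraction of \<open>f \<mapsto> 1 \<otimes> f\<close> on endomorphisms of \<open>I\<close> makes that map injective.
\<close>

lemma retract_Ident_tensor:
  assumes f: "f \<in> homset C I I"
  shows "\<l> I \<cdot>\<^bsub>C\<^esub> (Ident C I \<otimes>\<^sub>a f) \<cdot>\<^bsub>C\<^esub> \<rho> I = f"
proof -
  note If = tensor_homset[OF Ident_I_homset f]
  have "\<l> I \<cdot>\<^bsub>C\<^esub> (Ident C I \<otimes>\<^sub>a f) \<cdot>\<^bsub>C\<^esub> \<rho> I = (f \<cdot>\<^bsub>C\<^esub> \<l> I) \<cdot>\<^bsub>C\<^esub> \<rho> I"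
    using lambda.naturality[OF f] Comp_assoc[OF rho_I_homset If lambda_I_homset] by simp
  also have "\<dots> = f"
    using Comp_assoc[OF rho_I_homset lambda_I_homset f] unit_unit Comp_Ident_right[OF f] by simp
  finally show ?thesis .
qed

end

context weakly_normal_skew_monoidal_category
begin

text \<open>
  Both sides are the conjugate of \<open>f\<close> by the isomorphism \<open>\<rho>\<^sub>I\<close>, by naturality of \<open>\<rho>\<close> on the left
  and of \<open>\<l>\<close> on the right.
\<close>

lemma tensor_Ident_eq_Ident_tensor:
  assumes f: "f \<in> homset C I I"
  shows "f \<otimes>\<^sub>a Ident C I = Ident C I \<otimes>\<^sub>a f"
proof -
  note fI = tensor_homset[OF f Ident_I_homset] and If = tensor_homset[OF Ident_I_homset f]
  have "f \<otimes>\<^sub>a Ident C I = (f \<otimes>\<^sub>a Ident C I) \<cdot>\<^bsub>C\<^esub> \<rho> I \<cdot>\<^bsub>C\<^esub> \<l> I"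
    using weakly_normal Comp_Ident_right[OF fI] by simp
  also have "\<dots> = (\<rho> I \<cdot>\<^bsub>C\<^esub> f) \<cdot>\<^bsub>C\<^esub> \<l> I"
    using rho.naturality[OF f] Comp_assoc[OF lambda_I_homset rho_I_homset fI] by simp
  also have "\<dots> = \<rho> I \<cdot>\<^bsub>C\<^esub> f \<cdot>\<^bsub>C\<^esub> \<l> I"
    by (rule Comp_assoc[OF lambda_I_homset f rho_I_homset])
  also have "\<dots> = (\<rho> I \<cdot>\<^bsub>C\<^esub> \<l> I) \<cdot>\<^bsub>C\<^esub> (Ident C I \<otimes>\<^sub>a f)"
    using lambda.naturality[OF f] Comp_assoc[OF If lambda_I_homset rho_I_homset] by simp
  also have "\<dots> = Ident C I \<otimes>\<^sub>a f"
    using weakly_normal Comp_Ident_left[OF If] by simp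
  finally show ?thesis .
qed

lemma endomorphisms_of_unit_commute:
  assumes f: "f \<in> homset C I I" and g: "g \<in> homset C I I"
  shows "f \<cdot>\<^bsub>C\<^esub> g = g \<cdot>\<^bsub>C\<^esub> f"
proof -
  have Ident_tensor_Comp:
    "Ident C I \<otimes>\<^sub>a (h \<cdot>\<^bsub>C\<^esub> k) = (Ident C I \<otimes>\<^sub>a h) \<cdot>\<^bsub>C\<^esub> (Ident C I \<otimes>\<^sub>a k)"
    if "h \<in> homset C I I" "k \<in> homset C I I" for h k
    using tensor_Comp[OF Ident_I_homset Ident_I_homset that(2,1)]
      Comp_Ident_left[OF Ident_I_homset] by simp
  have "Ident C I \<otimes>\<^sub>a (f \<cdot>\<^bsub>C\<^esub> g) = (f \<otimes>\<^sub>a Ident C I) \<cdot>\<^bsub>C\<^esub> (Ident C I \<otimes>\<^sub>a g)"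
    by (simp add: Ident_tensor_Comp f g tensor_Ident_eq_Ident_tensor)
  also have "\<dots> = (Ident C I \<otimes>\<^sub>a g) \<cdot>\<^bsub>C\<^esub> (f \<otimes>\<^sub>a Ident C I)"
    by (rule tensor_interchange[OF f g])
  also have "\<dots> = Ident C I \<otimes>\<^sub>a (g \<cdot>\<^bsub>C\<^esub> f)"
    by (simp add: Ident_tensor_Comp f g tensor_Ident_eq_Ident_tensor)
  finally show ?thesis
    using retract_Ident_tensor Comp_homset f g by metis
qed

end

theorem proposition2p10:
  fixes C :: "('o, 'a) cat"
    and tensor_ob :: "'o \<Rightarrow> 'o \<Rightarrow> 'o"
    and tensor_arr :: "'a \<Rightarrow> 'a \<Rightarrow> 'a"
    and I :: 'o
    and \<alpha> :: "'o \<Rightarrow> 'o \<Rightarrow> 'o \<Rightarrow> 'a"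
    and \<l> :: "'o \<Rightarrow> 'a"
    and \<rho> :: "'o \<Rightarrow> 'a"
  assumes "weakly_normal_skew_monoidal_category C tensor_ob tensor_arr I \<alpha> \<l> \<rho>"
  shows "comm_monoid (End_monoid C I)"
proof -
  interpret weakly_normal_skew_monoidal_category C tensor_ob tensor_arr I \<alpha> \<l> \<rho>
    by (rule assms)
  show ?thesis
    by (rule monoid.monoid_comm_monoidI[OF End_monoid_is_monoid[OF unit_Ob]])
      (simp add: End_monoid_def endomorphisms_of_unit_commute)
qed

end
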